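(* For any convex set $\mathcal C\subset\mathbb R^d$, $\mathrm{span}\,\Delta(\mathcal X,\mathcal C)=\mathrm{dir}\left(\mathcal X^\star(\mathcal C)\right)$.
   Context: The decision set is $\mathcal X=\{x\in\mathbb R^d : Ax=b,\ x\ge 0\}$ with $A\in\mathbb R^{m\times d}$, $b\in\mathbb R^m$, assumed bounded. Notation: $\mathcal X^\angle$ is the set of extreme points of $\mathcal X$. For $x^\star\in\mathcal X^\angle$: - $\mathrm{FD}(x^\star)=\{\delta\in\mathbb R^d:\exists\varepsilon>0,\ x^\star+\varepsilon\delta\in\mathcal X\}$ is the cone of feasible directions; - $D(x^\star)$ is the set of extreme directions of $\mathrm{FD}(x^\star)$: the non-zero vectors of $\mathrm{FD}(x^\star)$ that cannot be written as a convex combination $\lambda u+(1-\lambda)v$, $\lambda\in(0,1)$, of two non-proportional (i.e. linearly independent) elements $u,v$ of $\mathrm{FD}(x^\star)$; - $\Lambda(x^\star)=\{c\in\mathbb R^d: x^\star\in\arg\min_{x\in\mathcal X}c^\top x\}$; - for $\delta\in D(x^\star)$, $F(x^\star,\delta)=\Lambda(x^\star)\cap\{\delta\}^\perp$. The set of relevant extreme directions is $$\Delta(\mathcal X,\mathcal C)=\{\delta\in\mathbb R^d:\exists x^\star\in\mathcal X^\angle,\ \delta\in D(x^\star)\text{ and }F(x^\star,\delta)\cap\mathcal C\ne\varnothing\}.$$ The set of reachable solutions is $\mathcal X^\star(\mathcal C)=\bigcup_{c\in\mathcal C}\arg\min_{x\in\mathcal X}c^\top x$, and $\mathrm{dir}(\mathcal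 X^\star(\mathcal C))=\mathrm{span}\{x_1-x_2: x_1,x_2\in\mathcal X^\star(\mathcal C)\}$. The span of the empty set is $\{0\}$. *)

theory Defs
  imports "HOL-Analysis.Analysis"
begin

text \<open>
  The definitions take the decision set as an arbitrary set \<open>X\<close>; only \<open>decision_set\<close> is polyhedral.
\<close>

definition decision_set :: "real^'d^'m \<Rightarrow> real^'m \<Rightarrow> (real^'d) set" where
  "decision_set A b = {x. A *v x = b \<and> (\<forall>i. 0 \<le> x $ i)}"

definition extreme_points :: "(real^'d) set \<Rightarrow> (real^'d) set" where
  "extreme_points X = {x. x extreme_point_of X}"

definition argmin_set :: "(real^'d) set \<Rightarrow> real^'d \<Rightarrow> (real^'d) set" where
  "argmin_set X c = {x. is_arg_min (\<lambda>y. c \<bullet> y) (\<lambda>y. y \<in> X) x}"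

definition feasible_directions :: "(real^'d) set \<Rightarrow> real^'d \<Rightarrow> (real^'d) set" where
  "feasible_directions X x = {\<delta>. \<exists>\<epsilon>>0. x + \<epsilon> *\<^sub>R \<delta> \<in> X}"

text \<open>
  The conjunct \<open>u \<noteq> v\<close> is needed because \<open>independent {u, u}\<close> holds for \<open>u \<noteq> 0\<close>.
\<close>

definition extreme_directions :: "(real^'d) set \<Rightarrow> real^'d \<Rightarrow> (real^'d) set" where
  "extreme_directions X x =
     {\<delta> \<in> feasible_directions X x. \<delta> \<noteq> 0 \<and>
        \<not> (\<exists>u \<in> feasible_directions X x. \<exists>v \<in> feasible_directions X x. \<exists>t::real.
              u \<noteq> v \<and> independent {u, v} \<and> 0 < t \<and> t < 1 \<and>
              \<delta> = t *\<^sub>R u + (1 - t) *\<^sub>R v)}"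

definition optimality_cone :: "(real^'d) set \<Rightarrow> real^'d \<Rightarrow> (real^'d) set" where
  "optimality_cone X x = {c. x \<in> argmin_set X c}"

definition optimality_face :: "(real^'d) set \<Rightarrow> real^'d \<Rightarrow> real^'d \<Rightarrow> (real^'d) set" where
  "optimality_face X x \<delta> = optimality_cone X x \<inter> orthogonal_comp {\<delta>}"

definition relevant_directions :: "(real^'d) set \<Rightarrow> (real^'d) set \<Rightarrow> (real^'d) set" where
  "relevant_directions X C =
     {\<delta>. \<exists>x \<in> extreme_points X. \<delta> \<in> extreme_directions X x \<and> optimality_face X x \<delta> \<inter> C \<noteq> {}}"

definition reachable_solutions :: "(real^'d) set \<Rightarrow> (real^'d) set \<Rightarrow> (real^'d) set" where
  "reachable_solutions X C = (\<Union>c\<in>C. argmin_set X c)"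

definition direction_space :: "(real^'d) set \<Rightarrow> (real^'d) set" where
  "direction_space S = span {x - y | x y. x \<in> S \<and> y \<in> S}"

end

theory Submission
  imports Defs
begin

text \<open>
  At a vertex \<open>v\<close> that is optimal for \<open>c\<close>, the feasible directions orthogonal to \<open>c\<close> form a face of
  the pointed cone of feasible directions, so they are spanned by extreme directions orthogonal to
  \<open>c\<close>. Hence all minimisers for one \<open>c \<in> C\<close> agree modulo the span of the relevant directions.
  Calling two vertices equivalent if they agree modulo this span, the unions of the optimality cones
  over the equivalence classes are finitely many closed sets which cover \<open>C\<close> and are disjoint
  on \<open>C\<close>. As \<open>C\<close> is connected, only one class is reachable.
\<close>

section \<open>Closedness and convexity of the decision set\<close>

lemma mem_decision_set: "x \<in> decision_set A b \<longleftrightarrow> A *v x = b \<and> (\<forall>i. 0 \<le> x $ i)"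
  by (simp add: decision_set_def)

lemma mem_argmin_set: "x \<in> argmin_set X c \<longleftrightarrow> x \<in> X \<and> (\<forall>y\<in>X. c \<bullet> x \<le> c \<bullet> y)"
  by (auto simp: argmin_set_def is_arg_min_def not_less)

lemma closed_decision_set:
  fixes A :: "real^'d^'m"
  shows "closed (decision_set A b)"
proof -
  have "decision_set A b = {x. A *v x = b} \<inter> (\<Inter>i. {x. 0 \<le> x $ i})"
    by (auto simp: decision_set_def)
  moreover have "closed {x. A *v x = b}"
    by (intro closed_Collect_eq continuous_intros)
  moreover have "closed {x::real^'d. 0 \<le> x $ i}" for i
    by (intro closed_Collect_le continuous_intros)
  ultimately show ?thesis
    by (simp add: closed_Int closed_INT)
qed

lemma convex_decision_set: "convex (decision_set A b)"
proof (rule convexI)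
  fix x y and u v :: real
  assume "x \<in> decision_set A b" "y \<in> decision_set A b" and uv: "0 \<le> u" "0 \<le> v" "u + v = 1"
  moreover have "u *\<^sub>R b + v *\<^sub>R b = b"
    using scaleR_left_distrib[of u v b] uv(3) by simp
  ultimately show "u *\<^sub>R x + v *\<^sub>R y \<in> decision_set A b"
    by (simp add: mem_decision_set matrix_vector_right_distrib matrix_vector_mult_scaleR)
qed

section \<open>Feasible directions and vertices\<close>

text \<open>Only the constraints tight at \<open>x\<close> restrict a direction. A coordinate with
  \<open>x $ i > 0\<close> stays nonnegative for all small steps, and as there are finitely many
  coordinates, one positive step serves them all.\<close>

lemma feasible_directions_decision_set:
  assumes "x \<in> decision_set A b"
  shows "\<delta> \<in> feasible_directions (decision_set A b) x \<longleftrightarrow>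
         A *v \<delta> = 0 \<and> (\<forall>i. x $ i = 0 \<longrightarrow> 0 \<le> \<delta> $ i)"
proof
  assume "\<delta> \<in> feasible_directions (decision_set A b) x"
  then obtain e where e: "e > 0" "x + e *\<^sub>R \<delta> \<in> decision_set A b"
    by (auto simp: feasible_directions_def)
  then have "e *\<^sub>R (A *v \<delta>) = 0"
    using assms by (simp add: mem_decision_set matrix_vector_right_distrib matrix_vector_mult_scaleR)
  moreover have "0 \<le> \<delta> $ i" if "x $ i = 0" for i
  proof -
    have "0 \<le> (x + e *\<^sub>R \<delta>) $ i"
      using e(2) by (simp add: mem_decision_set)
    then show ?thesis
      using e(1) that by (simp add: zero_le_mult_iff)
  qed
  ultimately show "A *v \<delta> = 0 \<and> (\<forall>i. x $ i = 0 \<longrightarrow> 0 \<le> \<delta> $ i)"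
    using e(1) by simp
next
  assume d: "A *v \<delta> = 0 \<and> (\<forall>i. x $ i = 0 \<longrightarrow> 0 \<le> \<delta> $ i)"
  have "\<forall>\<^sub>F e in at_right 0. 0 \<le> x $ i + e * \<delta> $ i" for i
  proof (cases "x $ i = 0")
    case True
    then show ?thesis
      using d by (auto simp: eventually_at_filter)
  next
    case False
    then have "0 < x $ i"
      using assms by (simp add: mem_decision_set less_le)
    moreover have "((\<lambda>e. x $ i + e * \<delta> $ i) \<longlongrightarrow> x $ i + 0 * \<delta> $ i) (at_right 0)"
      by (intro tendsto_intros)
    ultimately have "\<forall>\<^sub>F e in at_right 0. 0 < x $ i + e * \<delta> $ i"
      by (intro order_tendstoD(1)) auto
    then show ?thesis
      by eventually_elim simp
  qed
  then have "\<forall>\<^sub>F e in at_right 0. \<forall>i. 0 \<le> x $ i + e * \<delta> $ i"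
    by (rule eventually_all_finite)
  then have "\<forall>\<^sub>F e in at_right (0::real). 0 < e \<and> (\<forall>i. 0 \<le> x $ i + e * \<delta> $ i)"
    by (simp add: eventually_conj eventually_at_right_less)
  then obtain e where "0 < e" "\<forall>i. 0 \<le> x $ i + e * \<delta> $ i"
    using eventually_happens' [OF trivial_limit_at_right_real] by blast
  then show "\<delta> \<in> feasible_directions (decision_set A b) x"
    using assms d unfolding feasible_directions_def
    by (auto simp: mem_decision_set matrix_vector_right_distrib matrix_vector_mult_scaleR)
qed

text \<open>Steps along \<open>w\<close> and \<open>- w\<close> would place \<open>x\<close>
  strictly inside a segment of \<open>X\<close>. This is the pointedness of the cone of feasible
  directions at a vertex.\<close>

lemma extreme_point_no_opposite_directions:
  assumes "convex X" "x extreme_point_of X"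
    and "w \<in> feasible_directions X x" "- w \<in> feasible_directions X x"
  shows "w = 0"
proof (rule ccontr)
  assume w: "w \<noteq> 0"
  obtain e f where e: "e > 0" "x + e *\<^sub>R w \<in> X" and f: "f > 0" "x + f *\<^sub>R (- w) \<in> X"
    using assms(3,4) unfolding feasible_directions_def by blast
  have "x \<in> open_segment (x + e *\<^sub>R w) (x + f *\<^sub>R (- w))"
    unfolding in_segment
  proof (intro conjI exI)
    show "x + e *\<^sub>R w \<noteq> x + f *\<^sub>R (- w)"
    proof
      assume "x + e *\<^sub>R w = x + f *\<^sub>R (- w)"
      then have "(e + f) *\<^sub>R w = 0"
        by (simp add: scaleR_left_distrib)
      then show False
        using w e(1) f(1) by simp
    qed
    \<comment> \<open>The weight \<open>e / (e + f)\<close> is the root \<open>t\<close> of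
      \<open>(1 - t) * e - t * f\<close>, the coefficient of \<open>w\<close> in the
      combination.\<close>
    show "0 < e / (e + f)" "e / (e + f) < 1"
      using e(1) f(1) by auto
    have "(1 - e / (e + f)) * e - e / (e + f) * f = 0"
      using e(1) f(1) by (simp add: field_simps)
    moreover have "(1 - t) *\<^sub>R (x + e *\<^sub>R w) + t *\<^sub>R (x + f *\<^sub>R (- w)) =
        x + ((1 - t) * e - t * f) *\<^sub>R w" for t
      by (simp add: algebra_simps)
    ultimately show "x = (1 - e / (e + f)) *\<^sub>R (x + e *\<^sub>R w) + (e / (e + f)) *\<^sub>R (x + f *\<^sub>R (- w))"
      by simp
  qed
  then show False
    using assms(2) e(2) f(2) by (auto simp: extreme_point_of_def)
qed

text \<open>The sign conditions hold with equality, so both \<open>w\<close> and \<open>- w\<close>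
  are feasible directions, and pointedness applies.\<close>

lemma extreme_point_decision_set_kernel:
  assumes x: "x extreme_point_of decision_set A b"
    and "A *v w = 0" "\<And>i. x $ i = 0 \<Longrightarrow> w $ i = 0"
  shows "w = 0"
proof (rule extreme_point_no_opposite_directions[OF convex_decision_set x])
  have "x \<in> decision_set A b"
    using x by (simp add: extreme_point_of_def)
  then show "w \<in> feasible_directions (decision_set A b) x"
    "- w \<in> feasible_directions (decision_set A b) x"
    using assms(2,3) by (auto simp: feasible_directions_decision_set linear_neg[OF matrix_vector_mul_linear])
qed

text \<open>A vertex is determined by its set of zero coordinates: two vertices with the same set
  differ by a kernel vector vanishing on it.\<close>

lemma finite_extreme_points_decision_set: "finite (extreme_points (decision_set A b))"
proof (rule inj_on_finite[where f = "\<lambda>x. {i. x $ i = 0}" and B = UNIV])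
  show "inj_on (\<lambda>x. {i. x $ i = 0}) (extreme_points (decision_set A b))"
  proof (rule inj_onI)
    fix x y
    assume x: "x \<in> extreme_points (decision_set A b)" and y: "y \<in> extreme_points (decision_set A b)"
      and eq: "{i. x $ i = 0} = {i. y $ i = 0}"
    have "x \<in> decision_set A b" "y \<in> decision_set A b"
      using x y by (auto simp: extreme_points_def extreme_point_of_def)
    then have "A *v (y - x) = 0"
      by (simp add: mem_decision_set matrix_vector_mult_diff_distrib)
    moreover have "(y - x) $ i = 0" if "x $ i = 0" for i
      using that eq by (auto simp: set_eq_iff)
    moreover have "x extreme_point_of decision_set A b"
      using x by (simp add: extreme_points_def)
    ultimately have "y - x = 0"
      using extreme_point_decision_set_kernel by blast
    then show "x = y"
      by simp
  qed
qed auto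

section \<open>Decomposing feasible directions into extreme directions\<close>

text \<open>For a feasible direction, these are the inequalities of the feasible cone at
  \<open>x\<close> that are strict at \<open>\<delta>\<close>; they identify the smallest face of
  the cone containing it. Its cardinality is the induction measure below.\<close>

definition active_support :: "real^'d \<Rightarrow> real^'d \<Rightarrow> 'd set" where
  "active_support x \<delta> = {i. x $ i = 0 \<and> 0 < \<delta> $ i}"

text \<open>A ratio test as in the simplex method: starting at \<open>p\<close>, go along
  \<open>- q\<close> until a first coordinate in the support of \<open>q\<close> reaches zero. The
  step is nonnegative, so no new index enters the support.\<close>

lemma feasible_direction_reduce:
  assumes x: "x extreme_point_of decision_set A b"
    and p: "p \<in> feasible_directions (decision_set A b) x"
    and q: "q \<in> feasible_directions (decision_set A b) x" "q \<noteq> 0"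
  obtains s where "p - s *\<^sub>R q \<in> feasible_directions (decision_set A b) x"
    "active_support x (p - s *\<^sub>R q) \<subseteq> active_support x p"
    "\<not> active_support x q \<subseteq> active_support x (p - s *\<^sub>R q)"
proof -
  have "x \<in> decision_set A b"
    using x by (simp add: extreme_point_of_def)
  note fd = feasible_directions_decision_set[OF this]
  \<comment> \<open>The largest step keeping \<open>p - s *\<^sub>R q\<close> feasible.\<close>
  define s where "s = Min ((\<lambda>i. p $ i / q $ i) ` active_support x q)"
  \<comment> \<open>The minimum needs a nonempty index set: with empty support, \<open>q\<close>
    would vanish wherever \<open>x\<close> does and hence be zero.\<close>
  have "active_support x q \<noteq> {}"
  proof
    assume "active_support x q = {}"
    then have "q $ i = 0" if "x $ i = 0" for i
      using that q(1) by (fastforce simp: fd active_support_def less_le)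
    then show False
      using extreme_point_decision_set_kernel[OF x] q by (auto simp: fd)
  qed
  then have "s \<in> (\<lambda>i. p $ i / q $ i) ` active_support x q"
    unfolding s_def by (intro Min_in) auto
  then obtain j where j: "j \<in> active_support x q" "s = p $ j / q $ j"
    by auto
  have s0: "0 \<le> s"
    using j p by (auto simp: fd active_support_def)
  have s_le: "s * q $ i \<le> p $ i" if "i \<in> active_support x q" for i
  proof -
    have "s \<le> p $ i / q $ i"
      unfolding s_def using that by (intro Min_le) auto
    then show ?thesis
      using that by (simp add: active_support_def pos_le_divide_eq)
  qed
  have nonneg: "0 \<le> (p - s *\<^sub>R q) $ i" if "x $ i = 0" for i
  proof (cases "i \<in> active_support x q")
    case True
    then show ?thesis
      using s_le by simp
  next
    case False
    then have "q $ i = 0"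
      using q(1) that by (fastforce simp: fd active_support_def less_le)
    then show ?thesis
      using p that by (simp add: fd)
  qed
  show thesis
  proof (rule that)
    show "p - s *\<^sub>R q \<in> feasible_directions (decision_set A b) x"
      using nonneg p q(1)
      by (auto simp: fd matrix_vector_mult_diff_distrib matrix_vector_mult_scaleR)
    show "active_support x (p - s *\<^sub>R q) \<subseteq> active_support x p"
    proof
      fix i
      assume "i \<in> active_support x (p - s *\<^sub>R q)"
      then have i: "x $ i = 0" "s * q $ i < p $ i"
        by (auto simp: active_support_def)
      then have "0 \<le> s * q $ i"
        using s0 q(1) by (simp add: fd)
      then show "i \<in> active_support x p"
        using i by (simp add: active_support_def)
    qed
    have "j \<notin> active_support x (p - s *\<^sub>R q)"
      using j by (auto simp: active_support_def)
    then show "\<not> active_support x q \<subseteq> active_support x (p - s *\<^sub>R q)"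
      using j(1) by blast
  qed
qed

lemma optimality_cone_feasible_direction:
  assumes "c \<in> optimality_cone X x" "\<delta> \<in> feasible_directions X x"
  shows "0 \<le> c \<bullet> \<delta>"
proof -
  obtain e where "e > 0" "x + e *\<^sub>R \<delta> \<in> X"
    using assms(2) by (auto simp: feasible_directions_def)
  moreover from this have "c \<bullet> x \<le> c \<bullet> (x + e *\<^sub>R \<delta>)"
    using assms(1) by (auto simp: optimality_cone_def mem_argmin_set)
  ultimately show ?thesis
    by (simp add: inner_add_right zero_le_mult_iff)
qed

text \<open>If the difference were zero, then \<open>r\<close> would be nonzero and \<open>v\<close>
  a multiple of \<open>u\<close>. The lemma guarantees below that reducing \<open>u\<close> by
  \<open>\<delta>\<close> leaves a usable direction.\<close>

lemma independent_pair_combination_nonzero: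
  fixes u v :: "'a::real_vector"
  assumes "independent {u, v}" "u \<noteq> v" "0 < t" "t < 1"
  shows "u - r *\<^sub>R (t *\<^sub>R u + (1 - t) *\<^sub>R v) \<noteq> 0"
proof
  assume eq: "u - r *\<^sub>R (t *\<^sub>R u + (1 - t) *\<^sub>R v) = 0"
  have "u \<noteq> 0"
    using assms(1) dependent_zero by blast
  then have "r \<noteq> 0"
    using eq by auto
  have "(r * (1 - t)) *\<^sub>R v = (1 - r * t) *\<^sub>R u"
    using eq by (simp add: algebra_simps)
  then have "v = ((1 - r * t) / (r * (1 - t))) *\<^sub>R u"
    using \<open>r \<noteq> 0\<close> assms(4)
    by (metis (no_types, lifting) diff_gt_0_iff_gt less_irrefl mult_eq_0_iff vector_fraction_eq_iff)
  then have "v \<in> span {u}"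
    by (metis span_base span_scale singletonI)
  moreover have "v \<notin> span {u}"
    using assms(1,2) independent_insert[of v "{u}"] by (simp add: insert_commute)
  ultimately show False
    by contradiction
qed

text \<open>Induction on the size of the active support. A direction \<open>\<delta>\<close> that is
  neither zero nor extreme splits into \<open>u\<close> and \<open>v\<close>; reducing
  \<open>u\<close> by \<open>\<delta>\<close> gives \<open>w\<close>, reducing
  \<open>\<delta>\<close> by \<open>w\<close> gives a remainder, and both have strictly smaller
  support and stay orthogonal to \<open>c\<close>.\<close>

lemma feasible_direction_in_span_extreme_directions:
  assumes x: "x extreme_point_of decision_set A b"
    and c: "c \<in> optimality_cone (decision_set A b) x"
    and "\<delta> \<in> feasible_directions (decision_set A b) x" "c \<bullet> \<delta> = 0"
  shows "\<delta> \<in> span {d \<in> extreme_directions (decision_set A b) x. c \<bullet> d = 0}" (is "_ \<in> span ?E")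
  using assms(3,4)
proof (induction "card (active_support x \<delta>)" arbitrary: \<delta> rule: less_induct)
  case less
  let ?FD = "feasible_directions (decision_set A b) x"
  have smaller: "p \<in> span ?E"
    if "p \<in> ?FD" "c \<bullet> p = 0" "active_support x p \<subset> active_support x \<delta>" for p
    using less.hyps[of p] that psubset_card_mono[of "active_support x \<delta>"] by simp
  show ?case
  proof (cases "\<delta> = 0 \<or> \<delta> \<in> extreme_directions (decision_set A b) x")
    case True
    then show ?thesis
      using less.prems(2) by (auto simp: span_zero intro: span_base)
  next
    case False
    then obtain u v t where uv: "u \<in> ?FD" "v \<in> ?FD" "u \<noteq> v" "independent {u, v}"
      and t: "0 < t" "t < 1" and \<delta>: "\<delta> = t *\<^sub>R u + (1 - t) *\<^sub>R v"
      using less.prems(1) unfolding extreme_directions_def by blast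
    have "x \<in> decision_set A b"
      using x by (simp add: extreme_point_of_def)
    note fd = feasible_directions_decision_set[OF this]
    \<comment> \<open>Optimality makes both products nonnegative, so a vanishing combination with
      positive weights forces each to vanish.\<close>
    have "0 \<le> c \<bullet> u" "0 \<le> c \<bullet> v"
      using optimality_cone_feasible_direction[OF c] uv by auto
    moreover have "t * (c \<bullet> u) + (1 - t) * (c \<bullet> v) = 0"
      using less.prems(2) by (simp add: \<delta> inner_add_right)
    ultimately have cu: "c \<bullet> u = 0"
      using t by (simp add: add_nonneg_eq_0_iff)
    \<comment> \<open>At tight coordinates the entries of \<open>u\<close> and \<open>v\<close> are
      nonnegative and cannot cancel in \<open>\<delta>\<close>.\<close>
    have "active_support x u \<subseteq> active_support x \<delta>"
      using uv t by (auto simp: active_support_def \<delta> fd intro: add_pos_nonneg)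
    moreover obtain r where r: "u - r *\<^sub>R \<delta> \<in> ?FD"
      "active_support x (u - r *\<^sub>R \<delta>) \<subseteq> active_support x u"
      "\<not> active_support x \<delta> \<subseteq> active_support x (u - r *\<^sub>R \<delta>)"
      using feasible_direction_reduce[OF x uv(1) less.prems(1)] False by blast
    moreover define w where "w = u - r *\<^sub>R \<delta>"
    ultimately have w: "w \<in> ?FD" "active_support x w \<subset> active_support x \<delta>"
      by auto
    have cw: "c \<bullet> w = 0"
      using cu less.prems(2) by (simp add: w_def inner_diff_right)
    have "w \<noteq> 0"
      unfolding w_def \<delta> using uv t by (intro independent_pair_combination_nonzero)
    then obtain s where s: "\<delta> - s *\<^sub>R w \<in> ?FD"
      "active_support x (\<delta> - s *\<^sub>R w) \<subseteq> active_support x \<delta>"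
      "\<not> active_support x w \<subseteq> active_support x (\<delta> - s *\<^sub>R w)"
      using feasible_direction_reduce[OF x less.prems(1) w(1)] by blast
    have "w \<in> span ?E"
      using smaller w cw by blast
    \<comment> \<open>The index dropped in the second reduction lies in the support of
      \<open>w\<close>, hence in that of \<open>\<delta>\<close>, so the inclusion is
      strict.\<close>
    moreover have "\<delta> - s *\<^sub>R w \<in> span ?E"
      using s w(2) cw less.prems(2) by (intro smaller) (auto simp: inner_diff_right)
    ultimately have "(\<delta> - s *\<^sub>R w) + s *\<^sub>R w \<in> span ?E"
      by (intro span_add span_scale)
    then show ?thesis
      by simp
  qed
qed

section \<open>Minimisers of a single cost vector\<close>

text \<open>The difference is feasible with step 1 and orthogonal to \<open>c\<close>. The extreme
  directions spanning it are relevant because \<open>c\<close> itself lies in their optimality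
  faces.\<close>

lemma argmin_set_diff_in_span_relevant:
  assumes "c \<in> C" "x extreme_point_of decision_set A b"
    and "x \<in> argmin_set (decision_set A b) c" "y \<in> argmin_set (decision_set A b) c"
  shows "y - x \<in> span (relevant_directions (decision_set A b) C)"
proof -
  let ?X = "decision_set A b"
  have c: "c \<in> optimality_cone ?X x"
    using assms(3) by (simp add: optimality_cone_def)
  have "y - x \<in> feasible_directions ?X x"
    using assms(4) unfolding feasible_directions_def
    by (auto simp: mem_argmin_set intro!: exI[of _ 1])
  moreover have "c \<bullet> (y - x) = 0"
    using assms(3,4) by (force simp: mem_argmin_set inner_diff_right intro: antisym)
  ultimately have "y - x \<in> span {d \<in> extreme_directions ?X x. c \<bullet> d = 0}"
    using feasible_direction_in_span_extreme_directions assms(2) c by blast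
  moreover have "{d \<in> extreme_directions ?X x. c \<bullet> d = 0} \<subseteq> relevant_directions ?X C"
    using assms(1,2) c
    by (fastforce simp: relevant_directions_def extreme_points_def optimality_face_def
        orthogonal_comp_def orthogonal_def inner_commute)
  ultimately show ?thesis
    using span_mono by blast
qed

text \<open>The minimisers form a compact face, and an extreme point of a face is extreme in the
  whole set.\<close>

lemma argmin_set_extreme_point_exists:
  assumes "compact X" "convex X" "X \<noteq> {}"
  obtains v where "v extreme_point_of X" "v \<in> argmin_set X c"
proof -
  have "continuous_on X (\<lambda>y. c \<bullet> y)"
    by (intro continuous_intros)
  then obtain z where z: "z \<in> X" "\<And>y. y \<in> X \<Longrightarrow> c \<bullet> z \<le> c \<bullet> y"
    using continuous_attains_inf[OF assms(1,3)] by blast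
  have face: "(X \<inter> {y. c \<bullet> y = c \<bullet> z}) face_of X"
    using z(2) assms(2) by (intro face_of_Int_supporting_hyperplane_ge)
  then have "compact (X \<inter> {y. c \<bullet> y = c \<bullet> z})" "convex (X \<inter> {y. c \<bullet> y = c \<bullet> z})"
    using assms face_of_imp_compact face_of_imp_convex by auto
  then obtain v where v: "v extreme_point_of (X \<inter> {y. c \<bullet> y = c \<bullet> z})"
    using extreme_point_exists_convex z(1) by blast
  then have "v extreme_point_of X" "v \<in> X" "c \<bullet> v = c \<bullet> z"
    using extreme_point_of_face[OF face] by auto
  then show thesis
    using z(2) that by (simp add: mem_argmin_set)
qed

text \<open>For \<open>x \<in> X\<close> the cone is an intersection of closed half-spaces;
  otherwise it is empty.\<close>

lemma closed_optimality_cone: "closed (optimality_cone X x)"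
proof (cases "x \<in> X")
  case True
  then have "optimality_cone X x = (\<Inter>y\<in>X. {c. c \<bullet> x \<le> c \<bullet> y})"
    by (auto simp: optimality_cone_def mem_argmin_set)
  moreover have "closed {c. c \<bullet> x \<le> c \<bullet> y}" for y
    by (intro closed_Collect_le continuous_intros)
  ultimately show ?thesis
    by auto
next
  case False
  then show ?thesis
    by (simp add: optimality_cone_def mem_argmin_set)
qed

section \<open>Comparing different cost vectors by connectedness\<close>

lemma reachable_extreme_points_diff_in_span_relevant:
  assumes "bounded (decision_set A b)" "connected C"
    and "c \<in> C" "v extreme_point_of decision_set A b" "v \<in> argmin_set (decision_set A b) c"
    and "c' \<in> C" "v' extreme_point_of decision_set A b" "v' \<in> argmin_set (decision_set A b) c'"
  shows "v' - v \<in> span (relevant_directions (decision_set A b) C)"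
proof (rule ccontr)
  let ?X = "decision_set A b"
  let ?V = "span (relevant_directions ?X C)"
  assume neg: "v' - v \<notin> ?V"
  \<comment> \<open>\<open>P\<close> is the class of \<open>v\<close> modulo \<open>?V\<close>, and
    \<open>Q\<close> gathers all other classes; their optimality cones will separate
    \<open>C\<close>.\<close>
  define P where "P = {w \<in> extreme_points ?X. w - v \<in> ?V}"
  define Q where "Q = {w \<in> extreme_points ?X. w - v \<notin> ?V}"
  have fin: "finite P" "finite Q"
    by (simp_all add: P_def Q_def finite_extreme_points_decision_set)
  have "compact ?X"
    using assms(1) closed_decision_set by (simp add: compact_eq_bounded_closed)
  moreover have "?X \<noteq> {}"
    using assms(4) by (auto simp: extreme_point_of_def)
  ultimately have "\<exists>w. w extreme_point_of ?X \<and> w \<in> argmin_set ?X d" for d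
    using argmin_set_extreme_point_exists[OF _ convex_decision_set] by metis
  then have "C \<subseteq> (\<Union>w\<in>P. optimality_cone ?X w) \<union> (\<Union>w\<in>Q. optimality_cone ?X w)"
    by (auto simp: P_def Q_def extreme_points_def optimality_cone_def)
  moreover have "(\<Union>w\<in>P. optimality_cone ?X w) \<inter> (\<Union>w\<in>Q. optimality_cone ?X w) \<inter> C = {}"
  proof -
    \<comment> \<open>Two vertices optimal for the same \<open>d \<in> C\<close> agree modulo
      \<open>?V\<close>, so \<open>q\<close> would join \<open>p\<close> in the class of
      \<open>v\<close>.\<close>
    have False if d: "d \<in> C" "p \<in> P" "q \<in> Q"
      "d \<in> optimality_cone ?X p" "d \<in> optimality_cone ?X q" for d p q
    proof -
      have "q - p \<in> ?V"
        using d by (intro argmin_set_diff_in_span_relevant[of d])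
          (auto simp: P_def optimality_cone_def extreme_points_def)
      then have "(q - p) + (p - v) \<in> ?V"
        using d(2) by (intro span_add) (auto simp: P_def)
      then show False
        using d(3) by (simp add: Q_def)
    qed
    then show ?thesis
      by blast
  qed
  moreover have "closed (\<Union>w\<in>P. optimality_cone ?X w)" "closed (\<Union>w\<in>Q. optimality_cone ?X w)"
    using fin closed_optimality_cone by (auto intro!: closed_UN)
  ultimately have "(\<Union>w\<in>P. optimality_cone ?X w) \<inter> C = {} \<or> (\<Union>w\<in>Q. optimality_cone ?X w) \<inter> C = {}"
    by (intro connected_closedD[OF assms(2)])
  \<comment> \<open>Both closed sets meet \<open>C\<close>: the first contains \<open>c\<close>, the
    second \<open>c'\<close>.\<close>
  moreover have "v \<in> P" "v' \<in> Q"
    using assms(4,7) neg by (simp_all add: P_def Q_def extreme_points_def span_zero)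
  ultimately show False
    using assms(3,5,6,8) by (auto simp: optimality_cone_def)
qed

lemma reachable_solutions_diff_in_span_relevant:
  assumes bdd: "bounded (decision_set A b)" and C: "connected C"
    and "x \<in> reachable_solutions (decision_set A b) C"
    and "y \<in> reachable_solutions (decision_set A b) C"
  shows "x - y \<in> span (relevant_directions (decision_set A b) C)" (is "_ \<in> ?V")
proof -
  let ?X = "decision_set A b"
  obtain c c' where c: "c \<in> C" "x \<in> argmin_set ?X c" and c': "c' \<in> C" "y \<in> argmin_set ?X c'"
    using assms(3,4) by (auto simp: reachable_solutions_def)
  have X: "compact ?X" "?X \<noteq> {}"
    using bdd closed_decision_set c(2) by (auto simp: compact_eq_bounded_closed mem_argmin_set)
  obtain v where v: "v extreme_point_of ?X" "v \<in> argmin_set ?X c"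
    using argmin_set_extreme_point_exists[OF X(1) convex_decision_set X(2)] by blast
  obtain v' where v': "v' extreme_point_of ?X" "v' \<in> argmin_set ?X c'"
    using argmin_set_extreme_point_exists[OF X(1) convex_decision_set X(2)] by blast
  \<comment> \<open>Telescoping from \<open>x\<close> to \<open>y\<close> through the optimal
    vertices \<open>v\<close> and \<open>v'\<close>.\<close>
  have "(x - v) - (v' - v) - (y - v') \<in> ?V"
    using argmin_set_diff_in_span_relevant[OF c(1) v c(2)]
      reachable_extreme_points_diff_in_span_relevant[OF bdd C c(1) v c'(1) v']
      argmin_set_diff_in_span_relevant[OF c'(1) v' c'(2)]
    by (rule span_diff[OF span_diff])
  then show ?thesis
    by simp
qed

section \<open>The two inclusions\<close>

text \<open>A feasible step along a direction orthogonal to \<open>c\<close> preserves the cost, so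
  both ends of the step minimise \<open>c\<close> and their difference is a positive multiple of
  \<open>\<delta>\<close>.\<close>

lemma relevant_directions_subset_direction_space:
  "relevant_directions X C \<subseteq> direction_space (reachable_solutions X C)"
proof
  fix \<delta>
  assume "\<delta> \<in> relevant_directions X C"
  then obtain x c where "\<delta> \<in> extreme_directions X x" and c: "c \<in> C" "x \<in> argmin_set X c" "c \<bullet> \<delta> = 0"
    by (auto simp: relevant_directions_def optimality_face_def optimality_cone_def
        orthogonal_comp_def orthogonal_def inner_commute)
  then obtain e where e: "e > 0" "x + e *\<^sub>R \<delta> \<in> X"
    by (auto simp: extreme_directions_def feasible_directions_def)
  then have "x + e *\<^sub>R \<delta> \<in> argmin_set X c"
    using c by (simp add: mem_argmin_set inner_add_right)
  then have "x + e *\<^sub>R \<delta> \<in> reachable_solutions X C" "x \<in> reachable_solutions X C"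
    using c by (auto simp: reachable_solutions_def)
  then have "(x + e *\<^sub>R \<delta>) - x \<in> direction_space (reachable_solutions X C)"
    unfolding direction_space_def by (intro span_base) blast
  then have "e *\<^sub>R \<delta> \<in> direction_space (reachable_solutions X C)"
    by (simp only: add_diff_cancel_left')
  then show "\<delta> \<in> direction_space (reachable_solutions X C)"
    using e(1) span_scale[of "e *\<^sub>R \<delta>" _ "1 / e"] by (simp add: direction_space_def)
qed

theorem theorem2:
  fixes A :: "real^'d^'m" and b :: "real^'m" and C :: "(real^'d) set"
  assumes "bounded (decision_set A b)"
    and "convex C"
  shows "span (relevant_directions (decision_set A b) C) =
         direction_space (reachable_solutions (decision_set A b) C)"
proof
  show "span (relevant_directions (decision_set A b) C)
      \<subseteq> direction_space (reachable_solutions (decision_set A b) C)"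
    using relevant_directions_subset_direction_space
    by (intro span_minimal) (auto simp: direction_space_def)
  show "direction_space (reachable_solutions (decision_set A b) C)
      \<subseteq> span (relevant_directions (decision_set A b) C)"
    \<comment> \<open>Convexity of \<open>C\<close> enters through connectedness.\<close>
    unfolding direction_space_def
    using reachable_solutions_diff_in_span_relevant[OF assms(1) convex_connected[OF assms(2)]]
    by (intro span_minimal) auto
qed

end
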